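(* Let $G$ be a finite additive abelian group, $\Sigma=(\Gamma,\sigma)$ a signed graph with underlying graph $\Gamma=(V,E)$, and $\omega$ an orientation compatible with $\sigma$. Define $\delta:G^V\to G^E$ by $(\delta g)(e)=\omega(v,e)g(v)+\omega(u,e)g(u)$ for each edge $e$ with half-edges $(u,e),(v,e)$. Then $\delta$ is a group homomorphism (under pointwise addition), its image is contained in the group of $G$-tensions of $\Sigma$, and $$\ker\delta\cong G^{k_b(\Sigma)}\times G_2^{k_u(\Sigma)},$$ where $G_2=\{x\in G:2x=0\}$.
   Context: A signed graph $\Sigma=(\Gamma,\sigma)$: finite graph $\Gamma=(V,E)$ (loops, multiple edges allowed), $\sigma:E\to\{-1,1\}$. A cycle (loops included) is balanced if the product of its edge signs is $1$, unbalanced otherwise. $k_b$, $k_u$: numbers of connected components with all cycles balanced, resp. containing an unbalanced cycle. Each edge $e$ with endpoints $u,v$ has half-edges $(u,e),(v,e)$ (a loop at $v$ has two half-edges at $v$); an orientation $\omega$ assigns $\pm1$ to each half-edge, compatible with $\sigma$ if $\sigma(e)=-\omega(u,e)\omega(v,e)$. A walk $(v_1,e_1,\dots,v_k,e_k,v_{k+1})$ has $e_i$ joining $v_i,v_{i+1}$; $\omega(v_i,e_i)$ is the orientation of the half-edge of $e_i$ at $v_i$ by which the walk leaves $v_i$. Circuits of $\Sigma$: edge sets of balanced cycles, of unbalanced tight handcuffs (two unbalanced cycles sharing exactly one vertex) and of unbalanced loose handcuffs (two vertex-disjoint unbalanced cycles joined by a path meeting them only at its endpoints, whose edges are circuit path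 edges). A circuit walk is a closed walk traversing a circuit using circuit path edges twice and other edges once. $f:E\to G$ is a $G$-tension if for every circuit walk $(v_1,e_1,\dots,v_k,e_k,v_1)$, $\sum_{i=1}^k\big(\omega(v_i,e_i)\prod_{j<i}\sigma(e_j)\big)f(e_i)=0$. *)

theory Defs
  imports "HOL-Algebra.Algebra"
begin

section \<open>Signed graphs\<close>

text \<open>
  A half-edge is a pair (e, b): every edge e has the two half-edges (e, False) and (e, True),
  attached at the vertices ends e False and ends e True. A loop is an edge for which these two
  vertices coincide; it still has two half-edges. Which half-edge carries the label False is
  irrelevant.
\<close>

record ('v, 'e) pre_signed_graph =
  verts :: "'v set"
  edges :: "'e set"
  ends :: "'e \<Rightarrow> bool \<Rightarrow> 'v"
  edge_sign :: "'e \<Rightarrow> int"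

definition signed_graph :: "('v, 'e) pre_signed_graph \<Rightarrow> bool" where
  "signed_graph S \<longleftrightarrow>
     finite (verts S) \<and> finite (edges S) \<and>
     (\<forall>e\<in>edges S. \<forall>b. ends S e b \<in> verts S) \<and>
     (\<forall>e\<in>edges S. edge_sign S e \<in> {-1, 1})"

definition orientation :: "('v, 'e) pre_signed_graph \<Rightarrow> ('e \<Rightarrow> bool \<Rightarrow> int) \<Rightarrow> bool" where
  "orientation S \<omega> \<longleftrightarrow> (\<forall>e\<in>edges S. \<forall>b. \<omega> e b \<in> {-1, 1})"

definition compatible :: "('v, 'e) pre_signed_graph \<Rightarrow> ('e \<Rightarrow> bool \<Rightarrow> int) \<Rightarrow> bool" where
  "compatible S \<omega> \<longleftrightarrow> (\<forall>e\<in>edges S. edge_sign S e = - (\<omega> e False * \<omega> e True))"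

section \<open>Walks, cycles and components\<close>

text \<open>
  A walk is a list of half-edges: the entry (e, b) means that the walk leaves its current vertex
  ends e b through the half-edge (e, b) and arrives at the other end of e. This records the
  direction in which a loop is traversed.
\<close>

definition src :: "('v, 'e) pre_signed_graph \<Rightarrow> 'e \<times> bool \<Rightarrow> 'v" where
  "src S d = ends S (fst d) (snd d)"

definition dst :: "('v, 'e) pre_signed_graph \<Rightarrow> 'e \<times> bool \<Rightarrow> 'v" where
  "dst S d = ends S (fst d) (\<not> snd d)"

fun walk :: "('v, 'e) pre_signed_graph \<Rightarrow> 'v \<Rightarrow> ('e \<times> bool) list \<Rightarrow> 'v \<Rightarrow> bool" where
  "walk S u [] v \<longleftrightarrow> u = v \<and> u \<in> verts S"
| "walk S u (d # p) v \<longleftrightarrow> fst d \<in> edges S \<and> src S d = u \<and> walk S (dst S d) p v"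

definition walk_edges :: "('e \<times> bool) list \<Rightarrow> 'e set" where
  "walk_edges p = fst ` set p"

definition path :: "('v, 'e) pre_signed_graph \<Rightarrow> 'v \<Rightarrow> ('e \<times> bool) list \<Rightarrow> 'v \<Rightarrow> bool" where
  "path S u p v \<longleftrightarrow> walk S u p v \<and> distinct (u # map (dst S) p)"

definition path_verts :: "('v, 'e) pre_signed_graph \<Rightarrow> 'v \<Rightarrow> ('e \<times> bool) list \<Rightarrow> 'v set" where
  "path_verts S u p = insert u (dst S ` set p)"

text \<open>
  Loops are the cycles of length 1. Distinctness of the edges excludes going back and forth along
  a single edge, which is not a cycle.
\<close>

definition cycle :: "('v, 'e) pre_signed_graph \<Rightarrow> ('e \<times> bool) list \<Rightarrow> bool" where
  "cycle S c \<longleftrightarrow>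
     c \<noteq> [] \<and> (\<exists>v. walk S v c v) \<and> distinct (map (src S) c) \<and> distinct (map fst c)"

definition cycle_verts :: "('v, 'e) pre_signed_graph \<Rightarrow> ('e \<times> bool) list \<Rightarrow> 'v set" where
  "cycle_verts S c = src S ` set c"

definition balanced :: "('v, 'e) pre_signed_graph \<Rightarrow> ('e \<times> bool) list \<Rightarrow> bool" where
  "balanced S c \<longleftrightarrow> (\<Prod>d\<leftarrow>c. edge_sign S (fst d)) = 1"

definition connected_rel :: "('v, 'e) pre_signed_graph \<Rightarrow> ('v \<times> 'v) set" where
  "connected_rel S = {(u, v). u \<in> verts S \<and> v \<in> verts S \<and> (\<exists>p. walk S u p v)}"

definition components :: "('v, 'e) pre_signed_graph \<Rightarrow> 'v set set" where
  "components S = verts S // connected_rel S"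

definition k_b :: "('v, 'e) pre_signed_graph \<Rightarrow> nat" where
  "k_b S = card {C \<in> components S. \<forall>c. cycle S c \<and> cycle_verts S c \<subseteq> C \<longrightarrow> balanced S c}"

definition k_u :: "('v, 'e) pre_signed_graph \<Rightarrow> nat" where
  "k_u S = card {C \<in> components S. \<exists>c. cycle S c \<and> cycle_verts S c \<subseteq> C \<and> \<not> balanced S c}"

section \<open>Circuits and tensions\<close>

text \<open>
  circuit S C P: the edge set C is a circuit of S with set P of circuit path edges. In the tight
  case the edge sets have to be required to be different, since otherwise a single unbalanced
  loop, taken twice, would qualify.
\<close>

inductive circuit :: "('v, 'e) pre_signed_graph \<Rightarrow> 'e set \<Rightarrow> 'e set \<Rightarrow> bool"
  for S :: "('v, 'e) pre_signed_graph" where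
  balanced_cycle:
    "\<lbrakk>cycle S c; balanced S c\<rbrakk> \<Longrightarrow> circuit S (walk_edges c) {}"
| tight_handcuff:
    "\<lbrakk>cycle S c1; \<not> balanced S c1; cycle S c2; \<not> balanced S c2;
      walk_edges c1 \<noteq> walk_edges c2; cycle_verts S c1 \<inter> cycle_verts S c2 = {x}\<rbrakk>
     \<Longrightarrow> circuit S (walk_edges c1 \<union> walk_edges c2) {}"
| loose_handcuff:
    "\<lbrakk>cycle S c1; \<not> balanced S c1; cycle S c2; \<not> balanced S c2;
      cycle_verts S c1 \<inter> cycle_verts S c2 = {};
      path S x p y;
      path_verts S x p \<inter> cycle_verts S c1 = {x};
      path_verts S x p \<inter> cycle_verts S c2 = {y}\<rbrakk>
     \<Longrightarrow> circuit S (walk_edges c1 \<union> walk_edges p \<union> walk_edges c2) (walk_edges p)"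

definition circuit_walk :: "('v, 'e) pre_signed_graph \<Rightarrow> ('e \<times> bool) list \<Rightarrow> bool" where
  "circuit_walk S w \<longleftrightarrow>
     (\<exists>v. walk S v w v) \<and>
     (\<exists>C P. circuit S C P \<and> walk_edges w = C \<and>
        (\<forall>e\<in>C. count_list (map fst w) e = (if e \<in> P then 2 else 1)))"

text \<open>
  Abelian groups are written multiplicatively, as in HOL-Algebra: the integer multiple n x
  appears as the power of x with exponent n, and sums appear as products. The group of all
  functions from I to G is the product group of the constant family G over I.
\<close>

definition walk_sum ::
  "('v, 'e) pre_signed_graph \<Rightarrow> ('e \<Rightarrow> bool \<Rightarrow> int) \<Rightarrow> ('g, 'm) monoid_scheme \<Rightarrow>
   ('e \<times> bool) list \<Rightarrow> ('e \<Rightarrow> 'g) \<Rightarrow> 'g" where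
  "walk_sum S \<omega> G w f =
     finprod G
       (\<lambda>i. f (fst (w ! i)) [^]\<^bsub>G\<^esub>
              (\<omega> (fst (w ! i)) (snd (w ! i)) * (\<Prod>j<i. edge_sign S (fst (w ! j)))))
       {..<length w}"

definition tensions ::
  "('v, 'e) pre_signed_graph \<Rightarrow> ('e \<Rightarrow> bool \<Rightarrow> int) \<Rightarrow> ('g, 'm) monoid_scheme \<Rightarrow> ('e \<Rightarrow> 'g) set" where
  "tensions S \<omega> G =
     {f \<in> carrier (product_group (edges S) (\<lambda>_. G)).
        \<forall>w. circuit_walk S w \<longrightarrow> walk_sum S \<omega> G w f = \<one>\<^bsub>G\<^esub>}"

definition delta ::
  "('v, 'e) pre_signed_graph \<Rightarrow> ('e \<Rightarrow> bool \<Rightarrow> int) \<Rightarrow> ('g, 'm) monoid_scheme \<Rightarrow>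
   ('v \<Rightarrow> 'g) \<Rightarrow> 'e \<Rightarrow> 'g" where
  "delta S \<omega> G g =
     (\<lambda>e\<in>edges S. g (ends S e True) [^]\<^bsub>G\<^esub> \<omega> e True \<otimes>\<^bsub>G\<^esub> g (ends S e False) [^]\<^bsub>G\<^esub> \<omega> e False)"

definition two_torsion :: "('g, 'm) monoid_scheme \<Rightarrow> 'g set" where
  "two_torsion G = {x \<in> carrier G. x [^]\<^bsub>G\<^esub> (2::nat) = \<one>\<^bsub>G\<^esub>}"

section \<open>Well-definedness\<close>

lemma walk_end_in_verts: "walk S u p v \<Longrightarrow> v \<in> verts S"
  by (induction p arbitrary: u) auto

lemma walk_append: "walk S u p v \<Longrightarrow> walk S v q w \<Longrightarrow> walk S u (p @ q) w"
  by (induction p arbitrary: u) auto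

lemma walk_reverse:
  assumes "signed_graph S" "walk S u p v"
  shows "\<exists>q. walk S v q u"
  using assms(2)
proof (induction p arbitrary: u)
  case Nil
  then show ?case by (auto intro: exI[of _ "[]"])
next
  case (Cons d p)
  then obtain q where q: "walk S v q (dst S d)" by auto
  have "walk S (dst S d) [(fst d, \<not> snd d)] u"
    using Cons.prems assms(1) by (auto simp: src_def dst_def signed_graph_def)
  with q show ?case by (blast intro: walk_append)
qed

lemma equiv_connected_rel:
  assumes "signed_graph S"
  shows "equiv (verts S) (connected_rel S)"
proof (rule equivI)
  show "connected_rel S \<subseteq> verts S \<times> verts S"
    by (auto simp: connected_rel_def)
  show "refl_on (verts S) (connected_rel S)"
    by (auto simp: refl_on_def connected_rel_def intro: exI[of _ "[]"])
  show "sym (connected_rel S)"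
    using walk_reverse[OF assms] by (auto simp: sym_def connected_rel_def)
  show "trans (connected_rel S)"
    unfolding trans_def connected_rel_def by (blast intro: walk_append)
qed

lemma subgroup_two_torsion:
  assumes "comm_group G"
  shows "subgroup (two_torsion G) G"
proof -
  interpret comm_group G by fact
  show ?thesis
    by (rule subgroupI)
       (auto simp: two_torsion_def pow_mult_distrib m_comm nat_pow_inv intro: exI[of _ "\<one>\<^bsub>G\<^esub>"])
qed

lemma walk_edges_subset: "walk S u p v \<Longrightarrow> walk_edges p \<subseteq> edges S"
  by (induction p arbitrary: u) (auto simp: walk_edges_def)

lemma walk_sum_hom:
  assumes "comm_group G" "walk_edges w \<subseteq> edges S"
  shows "walk_sum S \<omega> G w \<in> hom (product_group (edges S) (\<lambda>_. G)) G"
proof -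
  interpret comm_group G by fact
  have e: "fst (w ! i) \<in> edges S" if "i < length w" for i
    using assms(2) that by (auto simp: walk_edges_def)
  show ?thesis
  proof (rule homI)
    fix f assume "f \<in> carrier (product_group (edges S) (\<lambda>_. G))"
    then show "walk_sum S \<omega> G w f \<in> carrier G"
      unfolding walk_sum_def using e by (intro finprod_closed) (auto simp: PiE_def Pi_def)
  next
    fix f g
    assume f: "f \<in> carrier (product_group (edges S) (\<lambda>_. G))"
      and g: "g \<in> carrier (product_group (edges S) (\<lambda>_. G))"
    have fc: "f (fst (w ! i)) \<in> carrier G" and gc: "g (fst (w ! i)) \<in> carrier G"
      if "i < length w" for i
      using f g e[OF that] by (auto simp: PiE_def Pi_def)
    let ?k = "\<lambda>i. \<omega> (fst (w ! i)) (snd (w ! i)) * (\<Prod>j<i. edge_sign S (fst (w ! j)))"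
    have "walk_sum S \<omega> G w (f \<otimes>\<^bsub>product_group (edges S) (\<lambda>_. G)\<^esub> g) =
          finprod G (\<lambda>i. f (fst (w ! i)) [^]\<^bsub>G\<^esub> ?k i \<otimes>\<^bsub>G\<^esub> g (fst (w ! i)) [^]\<^bsub>G\<^esub> ?k i) {..<length w}"
      unfolding walk_sum_def
      by (rule finprod_cong') (use fc gc e in \<open>auto simp: int_pow_distrib\<close>)
    also have "\<dots> = walk_sum S \<omega> G w f \<otimes>\<^bsub>G\<^esub> walk_sum S \<omega> G w g"
      unfolding walk_sum_def by (rule finprod_multf) (use fc gc in auto)
    finally show "walk_sum S \<omega> G w (f \<otimes>\<^bsub>product_group (edges S) (\<lambda>_. G)\<^esub> g) =
          walk_sum S \<omega> G w f \<otimes>\<^bsub>G\<^esub> walk_sum S \<omega> G w g" .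
  qed
qed

lemma subgroup_tensions:
  assumes "comm_group G"
  shows "subgroup (tensions S \<omega> G) (product_group (edges S) (\<lambda>_. G))"
proof -
  interpret comm_group G by fact
  let ?P = "product_group (edges S) (\<lambda>_. G)"
  interpret P: group ?P by simp
  have h: "group_hom ?P G (walk_sum S \<omega> G w)" if "circuit_walk S w" for w
    using that walk_sum_hom[OF assms] walk_edges_subset
    by (metis P.group_axioms circuit_walk_def group_axioms group_hom.intro group_hom_axioms_def)
  show ?thesis
  proof (rule P.subgroupI)
    show "tensions S \<omega> G \<subseteq> carrier ?P"
      by (auto simp: tensions_def)
    have "\<one>\<^bsub>?P\<^esub> \<in> tensions S \<omega> G"
      unfolding tensions_def using group_hom.hom_one[OF h] P.one_closed by blast
    then show "tensions S \<omega> G \<noteq> {}" by blast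
  next
    fix f assume "f \<in> tensions S \<omega> G"
    then show "inv\<^bsub>?P\<^esub> f \<in> tensions S \<omega> G"
      unfolding tensions_def using group_hom.hom_inv[OF h] P.inv_closed inv_one by fastforce
  next
    fix f g assume "f \<in> tensions S \<omega> G" "g \<in> tensions S \<omega> G"
    then show "f \<otimes>\<^bsub>?P\<^esub> g \<in> tensions S \<omega> G"
      unfolding tensions_def using group_hom.hom_mult[OF h] P.m_closed by fastforce
  qed
qed

end

theory Submission
  imports Defs
begin

text \<open>
  For a walk from u to v with sign product s, the walk sum of delta g telescopes to g u - s g v.
  A circuit walk is closed and s = 1, because the circuit path edges occur twice and the remaining
  edges form one balanced or two edge-disjoint unbalanced cycles; so delta g is a tension. The
  kernel consists of the g with g u = s g v for all walks, so g is determined by its values at one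
  root per component. An unbalanced closed walk contains an unbalanced cycle; hence in a balanced
  component s depends only on u and v and the value at the root is arbitrary, while in an
  unbalanced component exactly the values x = -x occur.
\<close>

section \<open>Signs of walks under concatenation and reversal\<close>

definition walk_sign :: "('v, 'e) pre_signed_graph \<Rightarrow> ('e \<times> bool) list \<Rightarrow> int" where
  "walk_sign S p = (\<Prod>d\<leftarrow>p. edge_sign S (fst d))"

lemma walk_sign_simps [simp]:
  "walk_sign S [] = 1"
  "walk_sign S (d # p) = edge_sign S (fst d) * walk_sign S p"
  "walk_sign S (p @ q) = walk_sign S p * walk_sign S q"
  by (simp_all add: walk_sign_def)

lemma balanced_iff_walk_sign: "balanced S c \<longleftrightarrow> walk_sign S c = 1"
  by (simp add: balanced_def walk_sign_def)

lemma walk_start_in_verts: "signed_graph S \<Longrightarrow> walk S u p v \<Longrightarrow> u \<in> verts S"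
  by (cases p) (auto simp: signed_graph_def src_def)

lemma walk_append_iff:
  "signed_graph S \<Longrightarrow> walk S u (p @ q) w \<longleftrightarrow> (\<exists>v. walk S u p v \<and> walk S v q w)"
  by (induction p arbitrary: u) (auto simp: walk_start_in_verts)

lemma walk_sign_cases:
  assumes "signed_graph S" "walk S u p v"
  shows "walk_sign S p = 1 \<or> walk_sign S p = -1"
  using assms(2)
proof (induction p arbitrary: u)
  case (Cons d p)
  then have "edge_sign S (fst d) \<in> {-1, 1}" "walk_sign S p = 1 \<or> walk_sign S p = -1"
    using assms(1) by (auto simp: signed_graph_def)
  then show ?case by auto
qed simp

lemma walk_reverse_sign:
  assumes "signed_graph S" "walk S u p v"
  shows "\<exists>q. walk S v q u \<and> walk_sign S q = walk_sign S p"
  using assms(2)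
proof (induction p arbitrary: u)
  case Nil
  then show ?case by (auto intro: exI[of _ "[]"])
next
  case (Cons d p)
  then obtain q where q: "walk S v q (dst S d)" "walk_sign S q = walk_sign S p" by auto
  have "walk S (dst S d) [(fst d, \<not> snd d)] u"
    using Cons.prems assms(1) by (auto simp: src_def dst_def signed_graph_def)
  with q have "walk S v (q @ [(fst d, \<not> snd d)]) u"
    by (blast intro: walk_append)
  then show ?case using q(2) by (intro exI[of _ "q @ [(fst d, \<not> snd d)]"]) simp
qed

text \<open>Keeps a cycle found inside a closed walk within the component of the starting
  vertex.\<close>

lemma walk_src_reachable:
  assumes "signed_graph S" "walk S u p v" "x \<in> src S ` set p"
  shows "\<exists>q. walk S u q x"
proof -
  from assms(3) obtain d where "d \<in> set p" "x = src S d" by auto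
  then obtain a b where "p = a @ d # b" by (meson split_list)
  with assms(1,2) \<open>x = src S d\<close> show ?thesis by (auto simp: walk_append_iff)
qed

section \<open>Unbalanced closed walks\<close>

text \<open>Two entries with the same edge but distinct sources are its two opposite half-edges, so
  the second leaves from where the first arrives. Distinct sources then leave no room for further
  entries: the walk goes along one edge and straight back, and its sign is a square.\<close>

lemma closed_walk_repeated_edge_sign:
  assumes S: "signed_graph S" and w: "walk S v w v"
    and src: "distinct (map (src S) w)" and edge: "\<not> distinct (map fst w)"
  shows "walk_sign S w = 1"
proof -
  obtain a d r where 1: "map fst w = a @ [d] @ r" "d \<in> set r"
    using not_distinct_decomp[OF edge] by fastforce
  then obtain a' x r' where w1: "w = a' @ x # r'" "fst x = d" "map fst r' = r"
    by (auto simp: map_eq_append_conv map_eq_Cons_conv)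
  with 1(2) obtain y where y: "y \<in> set r'" "fst y = d" by auto
  then obtain m c where r': "r' = m @ y # c" by (meson split_list)
  have w2: "w = a' @ x # m @ y # c" using w1 r' by simp
  have fxy: "fst y = fst x" using w1 y by simp
  have "src S x \<noteq> src S y" using src w2 by auto
  then have "y \<noteq> x" by blast
  then have "snd y = (\<not> snd x)" using fxy by (simp add: prod_eq_iff)
  then have sd: "src S y = dst S x" "dst S y = src S x"
    using fxy by (simp_all add: src_def dst_def)
  have wx: "walk S (dst S x) (m @ y # c) v" "walk S v a' (src S x)" "fst x \<in> edges S"
    using w w2 S by (auto simp: walk_append_iff)
  \<comment> \<open>The first entry of \<open>m\<close> would leave from \<open>dst S x\<close>,
    which is already the source of \<open>y\<close>. In the same way \<open>c\<close> and
    \<open>a'\<close> would each begin with a second departure from \<open>src S x\<close>.\<close>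
  have "m = []"
  proof (cases m)
    case (Cons z m')
    then have "src S z = src S y" using wx sd by simp
    then show ?thesis using src w2 Cons by auto
  qed
  then have wc: "walk S (src S x) c v" using wx sd by simp
  have "c = []"
  proof (cases c)
    case (Cons z m')
    then have "src S z = src S x" using wc by simp
    then show ?thesis using src w2 Cons by auto
  qed
  then have v: "v = src S x" using wc by simp
  have "a' = []"
  proof (cases a')
    case (Cons z m')
    then have "src S z = src S x" using wx v by simp
    then show ?thesis using src w2 Cons by auto
  qed
  moreover have "edge_sign S (fst x) \<in> {-1, 1}"
    using S wx(3) by (auto simp: signed_graph_def)
  ultimately show ?thesis using w2 \<open>m = []\<close> \<open>c = []\<close> fxy by auto
qed

text \<open>Induction on the length. A repeated vertex cuts the walk into two shorter closed walks
  whose signs multiply to the given one, so one of them has sign different from 1. If no vertex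
  repeats, the only obstacle to being a cycle is a repeated edge, and that would make the sign
  1.\<close>

lemma unbalanced_closed_walk_contains_cycle:
  assumes S: "signed_graph S" and "walk S v w v" and "walk_sign S w \<noteq> 1"
  shows "\<exists>c. cycle S c \<and> \<not> balanced S c \<and> cycle_verts S c \<subseteq> src S ` set w"
  using assms(2,3)
proof (induction "length w" arbitrary: v w rule: less_induct)
  case less
  show ?case
  proof (cases "distinct (map (src S) w)")
    case True
    then have "distinct (map fst w)"
      using closed_walk_repeated_edge_sign[OF S less.prems(1)] less.prems(2) by blast
    moreover have "w \<noteq> []" using less.prems(2) by auto
    ultimately have "cycle S w" using True less.prems(1) by (auto simp: cycle_def)
    then show ?thesis
      using less.prems(2) by (intro exI[of _ w]) (simp add: balanced_iff_walk_sign cycle_verts_def)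
  next
    case False
    then obtain l r t z where "map (src S) w = l @ [z] @ r @ [z] @ t"
      using not_distinct_decomp by metis
    then obtain a x m y c where w: "w = a @ x # m @ y # c" and xy: "src S x = src S y"
      by (auto simp: map_eq_append_conv append_eq_map_conv map_eq_Cons_conv Cons_eq_map_conv)
    \<comment> \<open>The loop between the two visits of the repeated vertex, and the walk that
      remains once it is cut out.\<close>
    have inner: "walk S (src S x) (x # m) (src S x)"
      and outer: "walk S v (a @ y # c) v"
      using less.prems(1) S xy unfolding w by (auto simp: walk_append_iff)
    have "walk_sign S w = walk_sign S (x # m) * walk_sign S (a @ y # c)"
      using w by simp
    then consider "walk_sign S (x # m) \<noteq> 1" | "walk_sign S (a @ y # c) \<noteq> 1"
      using less.prems(2) by fastforce
    then show ?thesis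
    proof cases
      case 1
      have "length (x # m) < length w" using w by simp
      from less.hyps[OF this inner 1] obtain k
        where "cycle S k" "\<not> balanced S k" "cycle_verts S k \<subseteq> src S ` set (x # m)" by blast
      moreover have "src S ` set (x # m) \<subseteq> src S ` set w" using w by auto
      ultimately show ?thesis by blast
    next
      case 2
      have "length (a @ y # c) < length w" using w by simp
      from less.hyps[OF this outer 2] obtain k
        where "cycle S k" "\<not> balanced S k" "cycle_verts S k \<subseteq> src S ` set (a @ y # c)" by blast
      moreover have "src S ` set (a @ y # c) \<subseteq> src S ` set w" using w by auto
      ultimately show ?thesis by blast
    qed
  qed
qed

section \<open>Signs of circuit walks\<close>

text \<open>Each entry arrives where the next one departs, and the last one arrives at the source of
  the first. So \<open>cycle_verts\<close>, defined by sources alone, contains both ends of every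
  edge of a cycle.\<close>

lemma closed_walk_dst_in_src:
  assumes "walk S u c u" "d \<in> set c"
  shows "dst S d \<in> src S ` set c"
proof -
  have "walk S x p y \<Longrightarrow> d \<in> set p \<Longrightarrow> dst S d \<in> insert y (src S ` set p)" for x p y
  proof (induction p arbitrary: x)
    case (Cons z p)
    then show ?case by (cases p) auto
  qed simp
  from this[OF assms] assms show ?thesis by (cases c) auto
qed

lemma cycle_edge_ends:
  assumes "cycle S c" "e \<in> walk_edges c"
  shows "ends S e b \<in> cycle_verts S c"
proof -
  from assms obtain v d where v: "walk S v c v" and d: "d \<in> set c" "fst d = e"
    by (auto simp: cycle_def walk_edges_def)
  have "src S d \<in> cycle_verts S c" "dst S d \<in> cycle_verts S c"
    using d closed_walk_dst_in_src[OF v d(1)] by (auto simp: cycle_verts_def)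
  then show ?thesis using d(2) by (cases "b = snd d") (auto simp: src_def dst_def)
qed

text \<open>After a loop the next entry would depart from the same vertex again, which distinctness
  of the sources forbids; likewise nothing can precede the loop.\<close>

lemma cycle_with_loop:
  assumes c: "cycle S c" and e: "e \<in> walk_edges c" and loop: "ends S e False = ends S e True"
  shows "walk_edges c = {e}"
proof -
  from c e obtain v d where v: "walk S v c v" and d: "d \<in> set c" "fst d = e"
    and src: "distinct (map (src S) c)"
    by (auto simp: cycle_def walk_edges_def)
  have sd: "src S d = dst S d" using d loop by (cases "snd d") (auto simp: src_def dst_def)
  obtain a r where s: "c = a @ d # r" using d(1) by (meson split_list)
  have w: "walk S x (a @ d # r) y \<Longrightarrow> walk S (dst S d) r y" for x y
    by (induction a arbitrary: x) auto
  have "r = []"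
    using w v src sd unfolding s by (cases r) fastforce+
  then have "v = src S d" using w v sd unfolding s by fastforce
  moreover from this have "a = []"
    using v src unfolding s by (cases a) auto
  ultimately show ?thesis using \<open>r = []\<close> s d by (simp add: walk_edges_def)
qed

text \<open>Each entry of a path joins consecutive members of a list of distinct vertices. This is
  what separates the path of a loose handcuff from its two cycles, which it meets in one vertex
  each.\<close>

lemma path_edge_not_loop:
  assumes "path S x p y" "e \<in> walk_edges p"
  shows "ends S e False \<noteq> ends S e True" and "ends S e b \<in> path_verts S x p"
proof -
  from assms(2) obtain d where d: "d \<in> set p" "fst d = e" by (auto simp: walk_edges_def)
  have "walk S x p y \<Longrightarrow> distinct (x # map (dst S) p) \<Longrightarrow>
    src S d \<noteq> dst S d \<and> src S d \<in> path_verts S x p \<and> dst S d \<in> path_verts S x p" for x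
    using d(1)
  proof (induction p arbitrary: x)
    case (Cons z p)
    show ?case
    proof (cases "d = z")
      case True
      then show ?thesis using Cons.prems by (auto simp: path_verts_def)
    next
      case False
      then show ?thesis using Cons.IH[of "dst S z"] Cons.prems by (auto simp: path_verts_def)
    qed
  qed simp
  then have *: "src S d \<noteq> dst S d" "src S d \<in> path_verts S x p" "dst S d \<in> path_verts S x p"
    using assms(1) by (auto simp: path_def)
  show "ends S e False \<noteq> ends S e True"
    using * d(2) by (cases "snd d") (auto simp: src_def dst_def)
  show "ends S e b \<in> path_verts S x p"
    using * d(2) by (cases "b = snd d") (auto simp: src_def dst_def)
qed

section \<open>Signs as products over edge sets, and the signs of circuits\<close>

lemma prod_list_map_eq_prod_count:
  fixes h :: "'a \<Rightarrow> 'b::comm_monoid_mult"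
  shows "(\<Prod>x\<leftarrow>xs. h x) = (\<Prod>x\<in>set xs. h x ^ count_list xs x)"
proof (induction xs)
  case (Cons a xs)
  have *: "(\<Prod>x\<in>set xs - {a}. h x ^ count_list (a # xs) x) = (\<Prod>x\<in>set xs - {a}. h x ^ count_list xs x)"
    by (rule prod.cong) auto
  have "(\<Prod>x\<in>set (a # xs). h x ^ count_list (a # xs) x) =
      h a * (h a ^ count_list xs a * (\<Prod>x\<in>set xs - {a}. h x ^ count_list xs x))"
    using * by (simp add: prod.insert_remove mult.assoc)
  also have "h a ^ count_list xs a * (\<Prod>x\<in>set xs - {a}. h x ^ count_list xs x) =
      (\<Prod>x\<in>set xs. h x ^ count_list xs x)"
    by (cases "a \<in> set xs") (simp_all add: prod.remove[of "set xs" a])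
  finally show ?case using Cons.IH by simp
qed simp

text \<open>The sign depends only on the multiplicities of the edges, so the order in which a
  circuit walk runs through its circuit is immaterial.\<close>

lemma walk_sign_count:
  "walk_sign S w = (\<Prod>e\<in>walk_edges w. edge_sign S e ^ count_list (map fst w) e)"
proof -
  have "walk_sign S w = prod_list (map (edge_sign S) (map fst w))"
    by (simp add: walk_sign_def comp_def)
  also have "\<dots> = (\<Prod>e\<in>set (map fst w). edge_sign S e ^ count_list (map fst w) e)"
    by (rule prod_list_map_eq_prod_count)
  finally show ?thesis by (simp add: walk_edges_def)
qed

lemma cycle_sign_eq_prod: "cycle S c \<Longrightarrow> walk_sign S c = prod (edge_sign S) (walk_edges c)"
  using prod.distinct_set_conv_list[of "map fst c" "edge_sign S"]
  by (simp add: cycle_def walk_edges_def walk_sign_def comp_def)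

lemma unbalanced_cycle_sign:
  "signed_graph S \<Longrightarrow> cycle S c \<Longrightarrow> \<not> balanced S c \<Longrightarrow> walk_sign S c = -1"
  unfolding cycle_def balanced_iff_walk_sign by (elim conjE exE) (drule (1) walk_sign_cases, simp)

lemma cycle_edges_subset: "cycle S c \<Longrightarrow> walk_edges c \<subseteq> edges S"
  unfolding cycle_def by (elim conjE exE) (rule walk_edges_subset)

lemma finite_walk_edges [simp]: "finite (walk_edges p)"
  by (simp add: walk_edges_def)

text \<open>The edges of \<open>C - P\<close> form one balanced cycle or two edge-disjoint
  unbalanced cycles, whose signs multiply as (-1)(-1) = 1. The work lies in proving the edge sets
  disjoint.\<close>

lemma circuit_sign:
  assumes S: "signed_graph S" and "circuit S C P"
  shows "finite C \<and> C \<subseteq> edges S \<and> prod (edge_sign S) (C - P) = 1"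
  using assms(2)
proof cases
  case (balanced_cycle c)
  then show ?thesis
    using cycle_sign_eq_prod[of S c] cycle_edges_subset[of S c]
    by (simp add: balanced_iff_walk_sign)
next
  case (tight_handcuff c1 c2 x)
  have disj: "walk_edges c1 \<inter> walk_edges c2 = {}"
  proof (rule ccontr)
    assume "walk_edges c1 \<inter> walk_edges c2 \<noteq> {}"
    then obtain e where e: "e \<in> walk_edges c1" "e \<in> walk_edges c2" by blast
    \<comment> \<open>A shared edge has both ends in the single common vertex, so it is a loop. Each
      cycle then consists of this loop alone, against
      \<open>walk_edges c1 \<noteq> walk_edges c2\<close>.\<close>
    have "ends S e b = x" for b
      using cycle_edge_ends[of S c1 e b] cycle_edge_ends[of S c2 e b] e tight_handcuff by blast
    then have "walk_edges c1 = {e}" "walk_edges c2 = {e}"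
      using cycle_with_loop e tight_handcuff by metis+
    then show False using tight_handcuff by simp
  qed
  have "prod (edge_sign S) (walk_edges c1 \<union> walk_edges c2) = walk_sign S c1 * walk_sign S c2"
    using disj tight_handcuff by (simp add: prod.union_disjoint cycle_sign_eq_prod)
  also have "\<dots> = 1" using unbalanced_cycle_sign[OF S] tight_handcuff by simp
  finally show ?thesis
    using tight_handcuff cycle_edges_subset[of S] by simp
next
  case (loose_handcuff c1 c2 x p y)
  have disj: "walk_edges c1 \<inter> walk_edges c2 = {}"
    using cycle_edge_ends loose_handcuff by (meson disjoint_iff)
  have disjP: "walk_edges p \<inter> walk_edges c = {}"
    if c: "cycle S c" "path_verts S x p \<inter> cycle_verts S c = {z}" for c z
  proof (rule ccontr)
    assume "walk_edges p \<inter> walk_edges c \<noteq> {}"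
    then obtain e where e: "e \<in> walk_edges p" "e \<in> walk_edges c" by blast
    \<comment> \<open>A path edge lying on the cycle would have both ends at the only common vertex,
      but a path contains no loop.\<close>
    have "ends S e b = z" for b
      using cycle_edge_ends[OF c(1) e(2)] path_edge_not_loop(2)[OF loose_handcuff(8) e(1)] c(2)
      by blast
    then show False using path_edge_not_loop(1)[OF loose_handcuff(8) e(1)] by simp
  qed
  have "C - P = walk_edges c1 \<union> walk_edges c2"
    using disjP[of c1 x] disjP[of c2 y] loose_handcuff by blast
  then have "prod (edge_sign S) (C - P) = walk_sign S c1 * walk_sign S c2"
    using disj loose_handcuff by (simp add: prod.union_disjoint cycle_sign_eq_prod)
  also have "\<dots> = 1" using unbalanced_cycle_sign[OF S] loose_handcuff by simp
  moreover have "finite C" using loose_handcuff by simp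
  moreover have "C \<subseteq> edges S"
    using loose_handcuff cycle_edges_subset[of S] walk_edges_subset[of S x p y]
    by (simp add: path_def)
  ultimately show ?thesis by simp
qed

text \<open>Circuit path edges contribute the square of a sign, and the remaining edges contribute
  the product over \<open>C - P\<close>.\<close>

lemma circuit_walk_sign:
  assumes S: "signed_graph S" and "circuit_walk S w"
  shows "walk_sign S w = 1"
proof -
  from assms(2) obtain C P where C: "circuit S C P" "walk_edges w = C"
    and cnt: "\<And>e. e \<in> C \<Longrightarrow> count_list (map fst w) e = (if e \<in> P then 2 else 1)"
    by (auto simp: circuit_walk_def)
  note sign = circuit_sign[OF S C(1)]
  have "walk_sign S w = (\<Prod>e\<in>C. if e \<in> P then 1 else edge_sign S e)"
    unfolding walk_sign_count C(2)
  proof (rule prod.cong)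
    fix e assume e: "e \<in> C"
    then have "edge_sign S e \<in> {-1, 1}" using sign S by (auto simp: signed_graph_def)
    then show "edge_sign S e ^ count_list (map fst w) e = (if e \<in> P then 1 else edge_sign S e)"
      using cnt[OF e] by auto
  qed simp
  also have "\<dots> = prod (edge_sign S) (C - P)"
    using sign by (intro prod.mono_neutral_cong_right) auto
  finally show ?thesis using sign by simp
qed

section \<open>The coboundary map\<close>

text \<open>With \<open>m\<close> and \<open>n\<close> the orientations of the two half-edges of an
  edge, \<open>- (m * n)\<close> is the edge sign by compatibility. So the vanishing of
  \<open>delta\<close> at an edge says that the two end values agree up to that sign.\<close>

lemma (in comm_group) pow_mult_pow_eq_one_iff:
  assumes "a \<in> carrier G" "b \<in> carrier G" "m \<in> {-1, 1::int}" "n \<in> {-1, 1::int}"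
  shows "a [^] m \<otimes> b [^] n = \<one> \<longleftrightarrow> a = b [^] (- (m * n))"
proof -
  have 1: "x \<otimes> y = \<one> \<longleftrightarrow> x = inv y" if "x \<in> carrier G" "y \<in> carrier G" for x y
    using that inv_equality by auto
  have 2: "inv x = y \<longleftrightarrow> x = inv y" if "x \<in> carrier G" "y \<in> carrier G" for x y
    using that by auto
  show ?thesis using assms by (auto simp: int_pow_neg 1 2)
qed

text \<open>By commutativity either half-edge may come first, so the value can be read in the
  direction in which a walk traverses the edge.\<close>

lemma (in comm_group) delta_apply:
  assumes "signed_graph S" "g \<in> verts S \<rightarrow> carrier G" "e \<in> edges S"
  shows "delta S \<omega> G g e = g (ends S e b) [^] \<omega> e b \<otimes> g (ends S e (\<not> b)) [^] \<omega> e (\<not> b)"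
proof -
  have "g (ends S e b) \<in> carrier G" for b using assms by (auto simp: signed_graph_def)
  then show ?thesis using assms by (cases b) (auto simp: delta_def m_comm)
qed

lemma (in comm_group) delta_closed:
  assumes "signed_graph S" "g \<in> verts S \<rightarrow> carrier G" "e \<in> edges S"
  shows "delta S \<omega> G g e \<in> carrier G"
proof -
  have "g (ends S e b) \<in> carrier G" for b using assms by (auto simp: signed_graph_def)
  then show ?thesis using assms(3) by (simp add: delta_def)
qed

text \<open>The coefficient of an entry involves only the signs of earlier edges. Appending at the
  end therefore leaves the old terms unchanged, which is why the telescoping induction runs from the
  right.\<close>

lemma (in comm_group) walk_sum_snoc:
  assumes "f \<in> edges S \<rightarrow> carrier G" "walk_edges (p @ [d]) \<subseteq> edges S"
  shows "walk_sum S \<omega> G (p @ [d]) f =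
    walk_sum S \<omega> G p f \<otimes> f (fst d) [^] (\<omega> (fst d) (snd d) * walk_sign S p)"
proof -
  have c: "f (fst ((p @ [d]) ! i)) \<in> carrier G" if "i < Suc (length p)" for i
    using assms that nth_mem[of i "p @ [d]"] by (fastforce simp: walk_edges_def)
  have cp: "f (fst (p ! i)) \<in> carrier G" if "i < length p" for i
    using c[of i] that by (simp add: nth_append)
  \<comment> \<open>The sign product in front of the last entry, which has index
    \<open>length p\<close>, runs over exactly the entries of \<open>p\<close>.\<close>
  have s: "(\<Prod>j<length p. edge_sign S (fst ((p @ [d]) ! j))) = walk_sign S p"
    by (simp add: walk_sign_def prod.list_conv_set_nth atLeast0LessThan nth_append)
  let ?t = "\<lambda>w i. f (fst (w ! i)) [^] (\<omega> (fst (w ! i)) (snd (w ! i)) *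
      (\<Prod>j<i. edge_sign S (fst (w ! j))))"
  have "walk_sum S \<omega> G (p @ [d]) f = finprod G (?t (p @ [d])) (insert (length p) {..<length p})"
    by (simp add: walk_sum_def lessThan_Suc)
  also have "\<dots> = ?t (p @ [d]) (length p) \<otimes> finprod G (?t (p @ [d])) {..<length p}"
    using c by (intro finprod_insert int_pow_closed funcsetI) (auto simp del: nth_append_length)
  also have "finprod G (?t (p @ [d])) {..<length p} = finprod G (?t p) {..<length p}"
  proof (rule finprod_cong')
    show "?t p \<in> {..<length p} \<rightarrow> carrier G"
      using cp by auto
    show "?t (p @ [d]) i = ?t p i" if "i \<in> {..<length p}" for i
      using that by (auto simp: nth_append)
  qed simp
  finally show ?thesis
    using c[of "length p"] cp s by (simp add: walk_sum_def m_comm)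
qed

text \<open>Additively, a last edge from a to v with sign t, after a prefix of sign s, contributes s
  g(a) - s t g(v). The first term cancels the end term of the prefix, leaving g(u) - s t
  g(v).\<close>

lemma (in comm_group) walk_sum_delta:
  assumes S: "signed_graph S" and o: "orientation S \<omega>" "compatible S \<omega>"
    and g: "g \<in> verts S \<rightarrow> carrier G" and "walk S u p v"
  shows "walk_sum S \<omega> G p (delta S \<omega> G g) = g u \<otimes> g v [^] (- walk_sign S p)"
  using assms(5)
proof (induction p arbitrary: v rule: rev_induct)
  case Nil
  then have "g u \<in> carrier G" using g by auto
  with Nil show ?case by (simp add: walk_sum_def int_pow_neg)
next
  case (snoc d p)
  let ?e = "fst d" and ?b = "snd d" and ?s = "walk_sign S p"
  have wp: "walk S u p (src S d)" and e: "?e \<in> edges S" and v: "v = dst S d"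
    using snoc.prems S by (auto simp: walk_append_iff)
  have verts: "u \<in> verts S" "src S d \<in> verts S" "v \<in> verts S"
    using walk_start_in_verts[OF S wp] walk_end_in_verts[OF wp]
      walk_end_in_verts[OF snoc.prems] by auto
  then have c: "g u \<in> carrier G" "g (src S d) \<in> carrier G" "g v \<in> carrier G" using g by auto
  have om: "\<omega> ?e b \<in> {-1, 1}" for b using o e by (auto simp: orientation_def)
  \<comment> \<open>In the last term the coefficient \<open>\<omega> ?e ?b\<close> multiplies both
    summands of \<open>delta\<close>: at the source it gives a square, at the target minus the edge
    sign.\<close>
  then have sq: "\<omega> ?e ?b * \<omega> ?e ?b = 1" by (metis empty_iff insert_iff mult_1 mult_minus1 minus_minus)
  have sg: "\<omega> ?e (\<not> ?b) * \<omega> ?e ?b = - edge_sign S ?e"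
    using o(2) e by (cases ?b) (auto simp: compatible_def)
  have f: "delta S \<omega> G g \<in> edges S \<rightarrow> carrier G"
    using delta_closed[OF S g] by blast
  have sub: "walk_edges (p @ [d]) \<subseteq> edges S" using walk_edges_subset[OF snoc.prems] .
  have "delta S \<omega> G g ?e = g (src S d) [^] \<omega> ?e ?b \<otimes> g v [^] \<omega> ?e (\<not> ?b)"
    using delta_apply[OF S g e, of \<omega> ?b] by (simp add: v src_def dst_def)
  then have "delta S \<omega> G g ?e [^] (\<omega> ?e ?b * ?s) =
      g (src S d) [^] (\<omega> ?e ?b * \<omega> ?e ?b * ?s) \<otimes> g v [^] (\<omega> ?e (\<not> ?b) * \<omega> ?e ?b * ?s)"
    using c by (simp add: int_pow_distrib int_pow_pow mult.assoc)
  also have "\<dots> = g (src S d) [^] ?s \<otimes> g v [^] (- walk_sign S (p @ [d]))"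
    unfolding sq sg by (simp add: mult.commute)
  finally have "walk_sum S \<omega> G (p @ [d]) (delta S \<omega> G g) =
      (g u \<otimes> g (src S d) [^] (- ?s)) \<otimes> (g (src S d) [^] ?s \<otimes> g v [^] (- walk_sign S (p @ [d])))"
    using walk_sum_snoc[OF f sub, of \<omega>] snoc.IH[OF wp] by simp
  also have "\<dots> = g u \<otimes> ((g (src S d) [^] (- ?s) \<otimes> g (src S d) [^] ?s) \<otimes> g v [^] (- walk_sign S (p @ [d])))"
    using c by (simp add: m_assoc del: walk_sign_simps)
  also have "g (src S d) [^] (- ?s) \<otimes> g (src S d) [^] ?s = \<one>"
    using c by (simp add: int_pow_neg)
  finally show ?case using c by (simp del: walk_sign_simps)
qed

lemma (in comm_group) delta_hom:
  assumes "signed_graph S"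
  shows "delta S \<omega> G \<in> hom (product_group (verts S) (\<lambda>_. G)) (product_group (edges S) (\<lambda>_. G))"
proof (rule homI)
  fix g assume "g \<in> carrier (product_group (verts S) (\<lambda>_. G))"
  then have "g \<in> verts S \<rightarrow> carrier G" by auto
  then show "delta S \<omega> G g \<in> carrier (product_group (edges S) (\<lambda>_. G))"
    using delta_closed[OF assms] by (auto simp: delta_def)
next
  fix g h
  assume g: "g \<in> carrier (product_group (verts S) (\<lambda>_. G))"
    and h: "h \<in> carrier (product_group (verts S) (\<lambda>_. G))"
  have v: "ends S e b \<in> verts S" if "e \<in> edges S" for e b
    using assms that by (auto simp: signed_graph_def)
  have c: "g (ends S e b) \<in> carrier G" "h (ends S e b) \<in> carrier G" if "e \<in> edges S" for e b
    using g h v[OF that] by (auto simp: PiE_def Pi_def)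
  show "delta S \<omega> G (g \<otimes>\<^bsub>product_group (verts S) (\<lambda>_. G)\<^esub> h) =
      delta S \<omega> G g \<otimes>\<^bsub>product_group (edges S) (\<lambda>_. G)\<^esub> delta S \<omega> G h"
    using c v by (auto simp: delta_def int_pow_distrib m_ac intro!: restrict_ext)
qed

lemma (in comm_group) delta_in_tensions:
  assumes S: "signed_graph S" and o: "orientation S \<omega>" "compatible S \<omega>"
    and g: "g \<in> carrier (product_group (verts S) (\<lambda>_. G))"
  shows "delta S \<omega> G g \<in> tensions S \<omega> G"
proof -
  have gP: "g \<in> verts S \<rightarrow> carrier G" using g by auto
  have "walk_sum S \<omega> G w (delta S \<omega> G g) = \<one>" if w: "circuit_walk S w" for w
  proof -
    from w obtain v where v: "walk S v w v" by (auto simp: circuit_walk_def)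
    have "g v \<in> carrier G" using gP walk_end_in_verts[OF v] by auto
    then show ?thesis
      using walk_sum_delta[OF S o gP v] circuit_walk_sign[OF S w] by (simp add: int_pow_neg)
  qed
  then show ?thesis using hom_in_carrier[OF delta_hom[OF S] g] by (auto simp: tensions_def)
qed

section \<open>The kernel\<close>

abbreviation delta_kernel ::
  "('v, 'e) pre_signed_graph \<Rightarrow> ('e \<Rightarrow> bool \<Rightarrow> int) \<Rightarrow> ('g, 'm) monoid_scheme \<Rightarrow> ('v \<Rightarrow> 'g) set" where
  "delta_kernel S \<omega> G \<equiv>
     kernel (product_group (verts S) (\<lambda>_. G)) (product_group (edges S) (\<lambda>_. G)) (delta S \<omega> G)"

text \<open>The condition counted by \<open>k_u\<close>; its negation is the one counted by
  \<open>k_b\<close>.\<close>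

definition unbalanced_on :: "('v, 'e) pre_signed_graph \<Rightarrow> 'v set \<Rightarrow> bool" where
  "unbalanced_on S C \<longleftrightarrow> (\<exists>c. cycle S c \<and> cycle_verts S c \<subseteq> C \<and> \<not> balanced S c)"

text \<open>Membership in the kernel becomes a transport rule along single edges. Quantifying over
  half-edges \<open>d\<close> states it in both directions, which are equivalent because the sign is
  its own inverse.\<close>

lemma (in comm_group) delta_kernel_iff:
  assumes S: "signed_graph S" and o: "orientation S \<omega>" "compatible S \<omega>"
    and g: "g \<in> carrier (product_group (verts S) (\<lambda>_. G))"
  shows "g \<in> delta_kernel S \<omega> G \<longleftrightarrow>
    (\<forall>d. fst d \<in> edges S \<longrightarrow> g (src S d) = g (dst S d) [^] edge_sign S (fst d))"
proof -
  have gP: "g \<in> verts S \<rightarrow> carrier G" using g by auto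
  have *: "delta S \<omega> G g (fst d) = \<one> \<longleftrightarrow> g (src S d) = g (dst S d) [^] edge_sign S (fst d)"
    if d: "fst d \<in> edges S" for d
  proof -
    have c: "g (ends S (fst d) b) \<in> carrier G" for b
      using gP S d by (auto simp: signed_graph_def)
    have om: "\<omega> (fst d) b \<in> {-1, 1}" for b using o d by (auto simp: orientation_def)
    have sg: "edge_sign S (fst d) = - (\<omega> (fst d) (snd d) * \<omega> (fst d) (\<not> snd d))"
      using o(2) d by (cases "snd d") (auto simp: compatible_def)
    show ?thesis
      unfolding delta_apply[OF S gP d, of \<omega> "snd d"] sg src_def dst_def
      by (rule pow_mult_pow_eq_one_iff[OF c c om om])
  qed
  have "g \<in> delta_kernel S \<omega> G \<longleftrightarrow> delta S \<omega> G g = (\<lambda>e\<in>edges S. \<one>)"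
    using g by (auto simp: kernel_def)
  also have "\<dots> \<longleftrightarrow> (\<forall>e\<in>edges S. delta S \<omega> G g e = \<one>)"
    by (auto simp: delta_def fun_eq_iff)
  also have "\<dots> \<longleftrightarrow> (\<forall>d. fst d \<in> edges S \<longrightarrow> delta S \<omega> G g (fst d) = \<one>)"
    by (metis fst_conv)
  finally show ?thesis using * by auto
qed

lemma (in comm_group) delta_kernel_walk:
  assumes S: "signed_graph S" and o: "orientation S \<omega>" "compatible S \<omega>"
    and g: "g \<in> delta_kernel S \<omega> G" and "walk S u p v"
  shows "g u = g v [^] walk_sign S p"
  using assms(5)
proof (induction p arbitrary: u)
  case Nil
  then have "g v \<in> carrier G" using g by (auto simp: kernel_def)
  with Nil show ?case by simp
next
  case (Cons d p)
  have gc: "g \<in> carrier (product_group (verts S) (\<lambda>_. G))" using g by (simp add: kernel_def)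
  have "v \<in> verts S" using walk_end_in_verts[OF Cons.prems] .
  then have v: "g v \<in> carrier G" using gc by auto
  have "g u = g (dst S d) [^] edge_sign S (fst d)"
    using iffD1[OF delta_kernel_iff[OF S o gc] g] Cons.prems by (metis walk.simps(2))
  also have "g (dst S d) = g v [^] walk_sign S p" using Cons by simp
  finally show ?case using v by (simp add: int_pow_pow mult.commute)
qed

section \<open>Components and the dependence of walk signs on the walk\<close>

lemma component_connected:
  assumes "signed_graph S" "C \<in> components S" "u \<in> C" "v \<in> C"
  shows "\<exists>p. walk S u p v"
proof -
  have "C \<in> verts S // connected_rel S" using assms(2) by (simp add: components_def)
  from quotient_eq_iff[OF equiv_connected_rel[OF assms(1)] this this assms(3,4)]
  have "(u, v) \<in> connected_rel S" by simp
  then show ?thesis by (simp add: connected_rel_def)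
qed

lemma component_closed:
  assumes "signed_graph S" "C \<in> components S" "u \<in> C" "walk S u p v"
  shows "v \<in> C"
proof -
  have "(u, v) \<in> connected_rel S"
    using assms walk_start_in_verts walk_end_in_verts by (fastforce simp: connected_rel_def)
  then show ?thesis
    using assms equiv_connected_rel[OF assms(1)] unfolding components_def
    by (meson in_quotient_imp_closed)
qed

lemma component_subset_verts:
  "signed_graph S \<Longrightarrow> C \<in> components S \<Longrightarrow> C \<subseteq> verts S"
  unfolding components_def by (rule in_quotient_imp_subset[OF equiv_connected_rel])

text \<open>If the signs differed, \<open>p\<close> followed by the reverse of \<open>q\<close>
  would be a closed walk of sign -1. It would contain an unbalanced cycle, all of whose vertices are
  reachable from \<open>u\<close> and hence lie in \<open>C\<close>.\<close>

lemma walk_sign_unique: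
  assumes S: "signed_graph S" and C: "C \<in> components S" "u \<in> C"
    and p: "walk S u p v" and q: "walk S u q v" and bal: "\<not> unbalanced_on S C"
  shows "walk_sign S p = walk_sign S q"
proof (rule ccontr)
  assume ne: "walk_sign S p \<noteq> walk_sign S q"
  obtain q' where q': "walk S v q' u" "walk_sign S q' = walk_sign S q"
    using walk_reverse_sign[OF S q] by blast
  have closed: "walk S u (p @ q') u" using p q' by (blast intro: walk_append)
  have "walk_sign S (p @ q') \<noteq> 1"
    using ne q'(2) walk_sign_cases[OF S p] walk_sign_cases[OF S q] by auto
  then obtain c where c: "cycle S c" "\<not> balanced S c" "cycle_verts S c \<subseteq> src S ` set (p @ q')"
    using unbalanced_closed_walk_contains_cycle[OF S closed] by blast
  have "src S ` set (p @ q') \<subseteq> C"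
    using walk_src_reachable[OF S closed] component_closed[OF S C] by blast
  then show False using c bal by (auto simp: unbalanced_on_def)
qed

lemma (in comm_group) two_torsion_iff:
  assumes "x \<in> carrier G"
  shows "x \<in> two_torsion G \<longleftrightarrow> x = inv x"
proof -
  have "x \<in> two_torsion G \<longleftrightarrow> x \<otimes> x = \<one>" using assms by (simp add: two_torsion_def numeral_2_eq_2)
  also have "\<dots> \<longleftrightarrow> x = inv x" using assms inv_equality r_inv by metis
  finally show ?thesis .
qed

text \<open>Transport once around an unbalanced cycle gives g(x) = -g(x) at a vertex x on it.
  Transport along a walk from \<open>v\<close> to x then gives g(v) = g(x) or g(v) = -g(x), so
  \<open>g v\<close> is its own inverse too.\<close>

lemma (in comm_group) delta_kernel_two_torsion:
  assumes S: "signed_graph S" and o: "orientation S \<omega>" "compatible S \<omega>"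
    and g: "g \<in> delta_kernel S \<omega> G"
    and C: "C \<in> components S" "unbalanced_on S C" "v \<in> C"
  shows "g v \<in> two_torsion G"
proof -
  obtain c where c: "cycle S c" "cycle_verts S c \<subseteq> C" "\<not> balanced S c"
    using C by (auto simp: unbalanced_on_def)
  then obtain x where x: "walk S x c x" by (auto simp: cycle_def)
  have "x \<in> cycle_verts S c" using x c(1) by (cases c) (auto simp: cycle_def cycle_verts_def)
  then have xC: "x \<in> C" using c by blast
  obtain p where p: "walk S v p x" using component_connected[OF S C(1,3) xC] by blast
  have car: "g y \<in> carrier G" if "y \<in> C" for y
    using component_subset_verts[OF S C(1)] g that by (auto simp: kernel_def)
  have "g x = g x [^] (-1::int)"
    using delta_kernel_walk[OF S o g x] unbalanced_cycle_sign[OF S c(1,3)] by simp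
  then have "g x = inv (g x)" using car[OF xC] by (simp add: int_pow_neg)
  moreover have "g v = g x \<or> g v = inv (g x)"
    using delta_kernel_walk[OF S o g p] walk_sign_cases[OF S p] car[OF xC]
    by (auto simp: int_pow_neg)
  ultimately have "g v = inv (g v)" by metis
  then show ?thesis using two_torsion_iff[OF car[OF C(3)]] by simp
qed

lemma (in comm_group) delta_kernel_determined_by_roots:
  assumes S: "signed_graph S" and o: "orientation S \<omega>" "compatible S \<omega>"
    and g: "g \<in> delta_kernel S \<omega> G" and h: "h \<in> delta_kernel S \<omega> G"
    and rt: "\<And>C. C \<in> components S \<Longrightarrow> rt C \<in> C"
    and eq: "\<And>C. C \<in> components S \<Longrightarrow> g (rt C) = h (rt C)"
  shows "g = h"
proof -
  have "g v = h v" if v: "v \<in> verts S" for v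
  proof -
    define C where "C = connected_rel S `` {v}"
    have C: "C \<in> components S" "v \<in> C"
      using v equiv_class_self[OF equiv_connected_rel[OF S]]
      by (auto simp: C_def components_def quotientI)
    obtain p where "walk S v p (rt C)" using component_connected[OF S C rt[OF C(1)]] by blast
    then show ?thesis
      using delta_kernel_walk[OF S o g] delta_kernel_walk[OF S o h] eq[OF C(1)] by metis
  qed
  \<comment> \<open>Members of the product group are \<open>undefined\<close> outside
    \<open>verts S\<close>, so agreement on the vertices is equality.\<close>
  moreover have "g \<in> extensional (verts S)" "h \<in> extensional (verts S)"
    using g h by (auto simp: kernel_def PiE_def)
  ultimately show ?thesis by (blast intro: extensionalityI)
qed

text \<open>Each root value is spread over its component along arbitrarily chosen walks. The choice
  does not matter: in a balanced component the sign of a walk is fixed by its ends, and in an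
  unbalanced one the value equals its own inverse.\<close>

lemma (in comm_group) delta_kernel_extension:
  assumes S: "signed_graph S" and o: "orientation S \<omega>" "compatible S \<omega>"
    and rt: "\<And>C. C \<in> components S \<Longrightarrow> rt C \<in> C"
    and z: "\<And>C. C \<in> components S \<Longrightarrow> z C \<in> carrier G"
    and z2: "\<And>C. C \<in> components S \<Longrightarrow> unbalanced_on S C \<Longrightarrow> z C \<in> two_torsion G"
  shows "\<exists>g\<in>delta_kernel S \<omega> G. \<forall>C\<in>components S. g (rt C) = z C"
proof -
  define comp where "comp v = connected_rel S `` {v}" for v
  have comp: "comp v \<in> components S" "v \<in> comp v" if "v \<in> verts S" for v
    using that equiv_class_self[OF equiv_connected_rel[OF S]]
    by (auto simp: comp_def components_def quotientI)
  have comp_eq: "comp v = C" if "C \<in> components S" "v \<in> C" for v C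
    using that unfolding comp_def components_def
    by (metis equiv_connected_rel[OF S] Image_singleton_iff equiv_class_eq_iff quotientE)
  have "\<forall>v\<in>verts S. \<exists>p. walk S (rt (comp v)) p v"
    using component_connected[OF S] comp rt by blast
  then obtain W where W: "\<And>v. v \<in> verts S \<Longrightarrow> walk S (rt (comp v)) (W v) v" by metis
  define g where "g = (\<lambda>v\<in>verts S. z (comp v) [^] walk_sign S (W v))"
  have unique: "z C [^] walk_sign S p = z C [^] walk_sign S q"
    if C: "C \<in> components S" and p: "walk S (rt C) p v" and q: "walk S (rt C) q v" for C p q v
  proof (cases "unbalanced_on S C")
    case True
    then have "z C = inv (z C)" using z2[OF C] two_torsion_iff[OF z[OF C]] by blast
    then show ?thesis
      using walk_sign_cases[OF S p] walk_sign_cases[OF S q] z[OF C] by (auto simp: int_pow_neg)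
  next
    case False
    then show ?thesis using walk_sign_unique[OF S C rt[OF C] p q] by simp
  qed
  have gc: "g \<in> carrier (product_group (verts S) (\<lambda>_. G))"
    using z comp by (auto simp: g_def)
  \<comment> \<open>The chosen walk to \<open>dst S d\<close> may be replaced by the chosen walk to
    \<open>src S d\<close> extended by \<open>d\<close>. The sign of \<open>d\<close> then occurs
    twice and cancels.\<close>
  have "g (src S d) = g (dst S d) [^] edge_sign S (fst d)" if d: "fst d \<in> edges S" for d
  proof -
    have v: "src S d \<in> verts S" "dst S d \<in> verts S"
      using S d by (auto simp: signed_graph_def src_def dst_def)
    define C where "C = comp (src S d)"
    have C: "C \<in> components S" "src S d \<in> C" using comp v by (auto simp: C_def)
    have step: "walk S (src S d) [d] (dst S d)" using d v by simp
    then have cd: "comp (dst S d) = C" using component_closed[OF S C step] comp_eq C by blast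
    have p: "walk S (rt C) (W (src S d) @ [d]) (dst S d)"
      using W[OF v(1)] step by (auto simp: C_def intro: walk_append)
    have q: "walk S (rt C) (W (dst S d)) (dst S d)" using W[OF v(2)] cd by simp
    have "edge_sign S (fst d) \<in> {-1, 1}" using S d by (auto simp: signed_graph_def)
    then have sq: "walk_sign S (W (src S d) @ [d]) * edge_sign S (fst d) = walk_sign S (W (src S d))"
      by auto
    have "g (dst S d) [^] edge_sign S (fst d) =
        (z C [^] walk_sign S (W (src S d) @ [d])) [^] edge_sign S (fst d)"
      using v cd unique[OF C(1) p q] by (simp add: g_def)
    also have "\<dots> = z C [^] walk_sign S (W (src S d))"
      using sq z[OF C(1)] by (simp add: int_pow_pow del: walk_sign_simps)
    also have "\<dots> = g (src S d)" using v by (simp add: g_def C_def)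
    finally show ?thesis by simp
  qed
  then have "g \<in> delta_kernel S \<omega> G" using delta_kernel_iff[OF S o gc] by blast
  moreover have "g (rt C) = z C" if C: "C \<in> components S" for C
  proof -
    have r: "rt C \<in> verts S" using component_subset_verts[OF S C] rt[OF C] by blast
    have c: "comp (rt C) = C" using comp_eq[OF C rt[OF C]] .
    have "g (rt C) = z C [^] walk_sign S (W (rt C))" using r c by (simp add: g_def)
    \<comment> \<open>The chosen walk from the root to itself need not be empty, but it may be
      exchanged for the empty one.\<close>
    also have "\<dots> = z C [^] walk_sign S []"
      using W[OF r] r c by (intro unique[OF C, of _ "rt C"]) auto
    finally show ?thesis using z[OF C] by simp
  qed
  ultimately show ?thesis by blast
qed

text \<open>The isomorphism evaluates a kernel element at one root per component, with balanced and
  unbalanced components listed separately. Injectivity and surjectivity are the determination by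
  root values and the extension of root values.\<close>

lemma (in comm_group) delta_kernel_iso:
  fixes S :: "('v, 'e) pre_signed_graph"
  assumes S: "signed_graph S" and o: "orientation S \<omega>" "compatible S \<omega>"
  shows "(product_group (verts S) (\<lambda>_. G))\<lparr>carrier := delta_kernel S \<omega> G\<rparr>
    \<cong> product_group {..<k_b S} (\<lambda>_. G)
       \<times>\<times> product_group {..<k_u S} (\<lambda>_. G\<lparr>carrier := two_torsion G\<rparr>)"
    (is "?K \<cong> ?B \<times>\<times> ?U")
proof -
  have fin: "finite (components S)"
    using S finite_quotient[of "verts S" "connected_rel S"]
    by (auto simp: components_def signed_graph_def connected_rel_def)
  define Bal where "Bal = {C \<in> components S. \<not> unbalanced_on S C}"
  define Unb where "Unb = {C \<in> components S. unbalanced_on S C}"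
  have "card Bal = k_b S" "card Unb = k_u S"
    by (auto simp: k_b_def k_u_def Bal_def Unb_def unbalanced_on_def intro!: arg_cong[where f=card])
  moreover have "finite Bal" "finite Unb" using fin by (auto simp: Bal_def Unb_def)
  \<comment> \<open>The target is indexed by numbers below \<open>k_b S\<close> and
    \<open>k_u S\<close>, so the components of each kind are enumerated.\<close>
  ultimately obtain b c where b: "bij_betw b {..<k_b S} Bal" and c: "bij_betw c {..<k_u S} Unb"
    by (metis ex_bij_betw_nat_finite lessThan_atLeast0)
  have bC: "b i \<in> components S" if "i < k_b S" for i
    using bij_betwE[OF b] that by (auto simp: Bal_def)
  have cC: "c i \<in> components S" "unbalanced_on S (c i)" if "i < k_u S" for i
    using bij_betwE[OF c] that by (auto simp: Unb_def)
  define rt where "rt C = (SOME v. v \<in> C)" for C :: "'v set"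
  have rt: "rt C \<in> C" if "C \<in> components S" for C
    using that in_quotient_imp_non_empty[OF equiv_connected_rel[OF S]]
    by (simp add: components_def rt_def some_in_eq)
  have rtV: "rt C \<in> verts S" if "C \<in> components S" for C
    using component_subset_verts[OF S that] rt[OF that] by blast
  define \<phi> where "\<phi> g = (\<lambda>i\<in>{..<k_b S}. g (rt (b i)), \<lambda>i\<in>{..<k_u S}. g (rt (c i)))"
    for g :: "'v \<Rightarrow> 'a"
  have closed: "\<phi> g \<in> carrier (?B \<times>\<times> ?U)" if g: "g \<in> delta_kernel S \<omega> G" for g
  proof -
    have "g (rt C) \<in> carrier G" if "C \<in> components S" for C
      using g rtV[OF that] by (auto simp: kernel_def)
    moreover have "g (rt (c i)) \<in> two_torsion G" if "i < k_u S" for i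
      using delta_kernel_two_torsion[OF S o g cC[OF that] rt[OF cC(1)[OF that]]] .
    ultimately show ?thesis using bC by (auto simp: \<phi>_def)
  qed
  have hom: "\<phi> \<in> hom ?K (?B \<times>\<times> ?U)"
    by (rule homI) (use closed bC cC rtV in \<open>auto simp: \<phi>_def intro!: restrict_ext\<close>)
  have inj: "inj_on \<phi> (delta_kernel S \<omega> G)"
  proof (rule inj_onI)
    fix g h assume g: "g \<in> delta_kernel S \<omega> G" and h: "h \<in> delta_kernel S \<omega> G" and eq: "\<phi> g = \<phi> h"
    show "g = h"
    proof (rule delta_kernel_determined_by_roots[OF S o g h rt])
      fix C assume "C \<in> components S"
      then have "C \<in> b ` {..<k_b S} \<or> C \<in> c ` {..<k_u S}"
        using bij_betw_imp_surj_on[OF b] bij_betw_imp_surj_on[OF c] by (auto simp: Bal_def Unb_def)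
      then show "g (rt C) = h (rt C)"
        using eq by (auto simp: \<phi>_def restrict_def fun_eq_iff split: if_splits)
    qed
  qed
  have surj: "y \<in> \<phi> ` delta_kernel S \<omega> G" if y: "y \<in> carrier (?B \<times>\<times> ?U)" for y
  proof -
    obtain y1 y2 where yy: "y = (y1, y2)" and y1: "y1 \<in> {..<k_b S} \<rightarrow>\<^sub>E carrier G"
      and y2: "y2 \<in> {..<k_u S} \<rightarrow>\<^sub>E two_torsion G"
      using y by (auto simp: DirProd_def)
    \<comment> \<open>A preimage of \<open>(y1, y2)\<close> must take these values at the roots;
      they are read off by inverting the two enumerations.\<close>
    define z where "z C = (if unbalanced_on S C then y2 (inv_into {..<k_u S} c C)
        else y1 (inv_into {..<k_b S} b C))" for C
    have zb: "z (b i) = y1 i" if "i < k_b S" for i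
      using that bij_betwE[OF b] bij_betw_imp_inj_on[OF b] by (auto simp: z_def Bal_def)
    have zc: "z (c i) = y2 i" if "i < k_u S" for i
      using that cC bij_betw_imp_inj_on[OF c] by (auto simp: z_def)
    have z2: "z C \<in> two_torsion G" if "C \<in> components S" "unbalanced_on S C" for C
    proof -
      have "C \<in> c ` {..<k_u S}" using that bij_betw_imp_surj_on[OF c] by (auto simp: Unb_def)
      then show ?thesis using zc y2 by auto
    qed
    have z1: "z C \<in> carrier G" if C: "C \<in> components S" for C
    proof (cases "unbalanced_on S C")
      case True
      then show ?thesis using z2[OF C] by (simp add: two_torsion_def)
    next
      case False
      then have "C \<in> b ` {..<k_b S}" using C bij_betw_imp_surj_on[OF b] by (auto simp: Bal_def)
      then show ?thesis using zb y1 by auto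
    qed
    obtain g where g: "g \<in> delta_kernel S \<omega> G" "\<forall>C\<in>components S. g (rt C) = z C"
      using delta_kernel_extension[OF S o, of rt z] rt z1 z2 by blast
    have "(\<lambda>i\<in>{..<k_b S}. g (rt (b i))) = y1"
      by (rule extensionalityI[of _ "{..<k_b S}"]) (use y1 g bC zb in \<open>auto simp: PiE_def\<close>)
    moreover have "(\<lambda>i\<in>{..<k_u S}. g (rt (c i))) = y2"
      by (rule extensionalityI[of _ "{..<k_u S}"]) (use y2 g cC zc in \<open>auto simp: PiE_def\<close>)
    ultimately have "\<phi> g = y" using yy by (simp add: \<phi>_def)
    then show ?thesis using g(1) by blast
  qed
  have "\<phi> ` delta_kernel S \<omega> G = carrier (?B \<times>\<times> ?U)"
    using closed surj by blast
  then have "bij_betw \<phi> (carrier ?K) (carrier (?B \<times>\<times> ?U))"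
    using inj by (simp add: bij_betw_def)
  then have "\<phi> \<in> iso ?K (?B \<times>\<times> ?U)" using hom by (simp only: iso_def mem_Collect_eq)
  then show ?thesis unfolding is_iso_def by blast
qed

theorem theorem7p13:
  fixes G :: "('g, 'm) monoid_scheme"
    and S :: "('v, 'e) pre_signed_graph"
    and \<omega> :: "'e \<Rightarrow> bool \<Rightarrow> int"
  assumes "comm_group G" and "finite (carrier G)"
    and "signed_graph S"
    and "orientation S \<omega>" and "compatible S \<omega>"
  shows "delta S \<omega> G \<in> hom (product_group (verts S) (\<lambda>_. G)) (product_group (edges S) (\<lambda>_. G))
    \<and> delta S \<omega> G ` carrier (product_group (verts S) (\<lambda>_. G)) \<subseteq> tensions S \<omega> G
    \<and> (product_group (verts S) (\<lambda>_. G))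
          \<lparr>carrier := kernel (product_group (verts S) (\<lambda>_. G))
                            (product_group (edges S) (\<lambda>_. G)) (delta S \<omega> G)\<rparr>
        \<cong> product_group {..<k_b S} (\<lambda>_. G)
           \<times>\<times> product_group {..<k_u S} (\<lambda>_. G\<lparr>carrier := two_torsion G\<rparr>)"
  by (intro conjI image_subsetI comm_group.delta_hom[OF assms(1,3)]
      comm_group.delta_in_tensions[OF assms(1,3-5)] comm_group.delta_kernel_iso[OF assms(1,3-5)])

end
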